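(* Let $\mathbb{T}=\mathbb{R}/\mathbb{Z}$, let $\alpha\in\mathbb{T}$, let $\Omega=\mathbb{T}^2$, and suppose that the skew-shift $T:\mathbb{T}^2\to\mathbb{T}^2$, $T(\omega_1,\omega_2)=(\omega_1+2\alpha,\ \omega_1+\omega_2)$, is minimal. Let $\mathrm{Leb}$ denote normalized Lebesgue measure on $\mathbb{T}^2$. Then the following are equivalent: (i) $\alpha$ is not badly approximable. (ii) $(\Omega,T)$ satisfies the global repetition property (GRP). (iii) $(\Omega,T,\mathrm{Leb})$ satisfies the metric repetition property (MRP). (iv) $(\Omega,T)$ satisfies the topological repetition property (TRP).
   Context: $T$ is minimal if for every $\omega$ the orbit $\{T^n\omega:n\in\mathbb{Z}\}$ is dense. For $x\in\mathbb{T}$, $\langle x\rangle=\mathrm{dist}_{\mathbb{T}}(x,0)=\min\{|x-p|:p\in\mathbb{Z}\}$ (with $x$ on the right any real representative). A number $\alpha\in\mathbb{T}$ is called badly approximable if there is a constant $c>0$ such that $\langle\alpha q\rangle>\frac{c}{q}$ for every $q\in\mathbb{Z}\setminus\{0\}$. $\mathbb{T}^2$ carries its usual flat metric $\mathrm{dist}$ (the notions below do not depend on the choice of compatible metric, by compactness). Let $\Omega$ be a compact metric space and $T:\Omega\to\Omega$ a homeomorphism. A sequence $\{\omega_k\}_{k\ge 0}$ in $\Omega$ has the repetition property if for every $\varepsilon>0$ and $r>0$ there exists a positive integer $q$ such that $\mathrm{dist}(\omega_k,\omega_{k+q})<\varepsilon$ for $k=0,1,2,\ldots,\lfloor rq\rfloor$.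 Set $PRP(\Omega,T)=\{\omega\in\Omega : \{T^k\omega\}_{k\ge 0}\text{ has the repetition property}\}$. (TRP): $(\Omega,T)$ satisfies the topological repetition property if $PRP(\Omega,T)\ne\emptyset$. (MRP): for a $T$-ergodic Borel probability measure $\mu$, $(\Omega,T,\mu)$ satisfies the metric repetition property if $\mu(PRP(\Omega,T))>0$. (GRP): $(\Omega,T)$ satisfies the global repetition property if $PRP(\Omega,T)=\Omega$. *)

theory Defs
  imports "HOL-Analysis.Analysis" "HOL-Probability.Probability_Measure"
begin

quotient_type circle = real / "\<lambda>x y :: real. x - y \<in> \<int>"
  morphisms rep_circle circle_of
proof (rule equivpI)
  show "reflp (\<lambda>x y :: real. x - y \<in> \<int>)"
    by (simp add: reflp_def)
  show "symp (\<lambda>x y :: real. x - y \<in> \<int>)"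
  proof (rule sympI)
    fix x y :: real
    assume "x - y \<in> \<int>"
    then have "- (x - y) \<in> \<int>" by (rule Ints_minus)
    then show "y - x \<in> \<int>" by simp
  qed
  show "transp (\<lambda>x y :: real. x - y \<in> \<int>)"
  proof (rule transpI)
    fix x y z :: real
    assume "x - y \<in> \<int>" "y - z \<in> \<int>"
    then have "(x - y) + (y - z) \<in> \<int>" by (rule Ints_add)
    then show "x - z \<in> \<int>" by simp
  qed
qed

instantiation circle :: ab_group_add
begin

lift_definition zero_circle :: circle is 0 .

lift_definition plus_circle :: "circle \<Rightarrow> circle \<Rightarrow> circle" is "(+)"
proof -
  fix x x' y y' :: real
  assume "x - x' \<in> \<int>" "y - y' \<in> \<int>"
  then have "(x - x') + (y - y') \<in> \<int>" by (rule Ints_add)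
  then show "x + y - (x' + y') \<in> \<int>" by (simp add: algebra_simps)
qed

lift_definition uminus_circle :: "circle \<Rightarrow> circle" is uminus
proof -
  fix x x' :: real
  assume "x - x' \<in> \<int>"
  then have "- (x - x') \<in> \<int>" by (rule Ints_minus)
  then show "- x - - x' \<in> \<int>" by simp
qed

lift_definition minus_circle :: "circle \<Rightarrow> circle \<Rightarrow> circle" is "(-)"
proof -
  fix x x' y y' :: real
  assume "x - x' \<in> \<int>" "y - y' \<in> \<int>"
  then have "(x - x') - (y - y') \<in> \<int>" by (rule Ints_diff)
  then show "x - y - (x' - y') \<in> \<int>" by (simp add: algebra_simps)
qed

instance
  by standard (transfer; simp)+

end

lift_definition zscale :: "int \<Rightarrow> circle \<Rightarrow> circle" is "\<lambda>q x. of_int q * x"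
proof -
  fix q :: int and x x' :: real
  assume "x - x' \<in> \<int>"
  then have "of_int q * (x - x') \<in> \<int>" by (intro Ints_mult Ints_of_int)
  then show "of_int q * x - of_int q * x' \<in> \<int>" by (simp add: algebra_simps)
qed

text \<open>The infimum is a minimum, by \<open>circle_norm_attained\<close> below.\<close>

lift_definition circle_norm :: "circle \<Rightarrow> real" is "\<lambda>x. INF p::int. \<bar>x - of_int p\<bar>"
proof -
  fix x y :: real
  assume "x - y \<in> \<int>"
  then obtain m where m: "x - y = of_int m" by (elim Ints_cases)
  have "range (\<lambda>p::int. \<bar>x - of_int p\<bar>) = range (\<lambda>p::int. \<bar>y - of_int p\<bar>)"
  proof (intro equalityI subsetI; clarify)
    fix p
    have "\<bar>x - of_int p\<bar> = \<bar>y - of_int (p - m)\<bar>" using m by simp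
    then show "\<bar>x - of_int p\<bar> \<in> range (\<lambda>p::int. \<bar>y - of_int p\<bar>)" by blast
  next
    fix p
    have "\<bar>y - of_int p\<bar> = \<bar>x - of_int (p + m)\<bar>" using m by (simp add: algebra_simps)
    then show "\<bar>y - of_int p\<bar> \<in> range (\<lambda>p::int. \<bar>x - of_int p\<bar>)" by blast
  qed
  then show "(INF p::int. \<bar>x - of_int p\<bar>) = (INF p::int. \<bar>y - of_int p\<bar>)" by simp
qed

lemma circle_norm_le: "circle_norm (circle_of x) \<le> \<bar>x - of_int p\<bar>"
  unfolding circle_norm.abs_eq by (rule cINF_lower) (auto intro!: bdd_belowI[of _ 0])

lemma circle_norm_attained: "\<exists>p. circle_norm (circle_of x) = \<bar>x - of_int p\<bar>"
proof -
  have "\<bar>x - of_int (round x)\<bar> \<le> (INF p::int. \<bar>x - of_int p\<bar>)"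
    by (rule cINF_greatest) (use round_diff_minimal in auto)
  then show ?thesis
    using circle_norm_le[of x "round x"] by (metis antisym circle_norm.abs_eq)
qed

lemma circle_exhaust: obtains x where "c = circle_of x"
  by (metis Quotient3_abs_rep Quotient3_circle)

lemma circle_of_eq_iff: "circle_of x = circle_of y \<longleftrightarrow> x - y \<in> \<int>"
  by (rule circle.abs_eq_iff)

lemma circle_norm_eq_0_iff: "circle_norm c = 0 \<longleftrightarrow> c = 0"
proof -
  obtain x where c: "c = circle_of x" by (rule circle_exhaust)
  obtain p where p: "circle_norm c = \<bar>x - of_int p\<bar>" using circle_norm_attained c by metis
  show ?thesis
  proof
    assume "circle_norm c = 0"
    then have "x = of_int p" using p by simp
    then show "c = 0" by (simp add: c zero_circle_def circle_of_eq_iff)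
  next
    assume "c = 0"
    then have "x \<in> \<int>" by (simp add: c zero_circle_def circle_of_eq_iff)
    then obtain m where "x = of_int m" by (elim Ints_cases)
    then have "circle_norm c \<le> 0" using circle_norm_le[of x m] c by simp
    then show "circle_norm c = 0" using p by simp
  qed
qed

lemma circle_norm_minus: "circle_norm (- c) = circle_norm c"
proof -
  have le: "circle_norm (- c) \<le> circle_norm c" for c
  proof -
    obtain x where c: "c = circle_of x" by (rule circle_exhaust)
    obtain p where p: "circle_norm c = \<bar>x - of_int p\<bar>" using circle_norm_attained c by metis
    have "circle_norm (circle_of (- x)) \<le> \<bar>- x - of_int (- p)\<bar>" by (rule circle_norm_le)
    then show ?thesis using p by (simp add: c uminus_circle.abs_eq)
  qed
  show ?thesis using le[of c] le[of "- c"] by simp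
qed

lemma circle_norm_triangle: "circle_norm (c + d) \<le> circle_norm c + circle_norm d"
proof -
  obtain x y where c: "c = circle_of x" "d = circle_of y" by (metis circle_exhaust)
  obtain p q where p: "circle_norm c = \<bar>x - of_int p\<bar>" "circle_norm d = \<bar>y - of_int q\<bar>"
    using circle_norm_attained c by metis
  have "circle_norm (circle_of (x + y)) \<le> \<bar>x + y - of_int (p + q)\<bar>" by (rule circle_norm_le)
  then show ?thesis using p by (simp add: c plus_circle.abs_eq)
qed

instantiation circle :: metric_space
begin

definition dist_circle :: "circle \<Rightarrow> circle \<Rightarrow> real"
  where "dist_circle x y = circle_norm (x - y)"

definition uniformity_circle :: "(circle \<times> circle) filter"
  where "uniformity_circle = (INF e\<in>{0 <..}. principal {(x, y). dist x y < e})"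

definition open_circle :: "circle set \<Rightarrow> bool"
  where "open_circle U \<longleftrightarrow> (\<forall>x\<in>U. eventually (\<lambda>(x', y). x' = x \<longrightarrow> y \<in> U) uniformity)"

instance
proof
  fix x y z :: circle
  show "dist x y = 0 \<longleftrightarrow> x = y"
    by (simp add: dist_circle_def circle_norm_eq_0_iff)
  have "circle_norm ((x - z) + - (y - z)) \<le> circle_norm (x - z) + circle_norm (- (y - z))"
    by (rule circle_norm_triangle)
  then show "dist x y \<le> dist x z + dist y z"
    unfolding circle_norm_minus dist_circle_def by simp
qed (rule uniformity_circle_def open_circle_def)+

end

lemma dist_circle_of_le: "dist (circle_of x) (circle_of y) \<le> dist x y"
  using circle_norm_le[of "x - y" 0] by (simp add: dist_circle_def minus_circle.abs_eq dist_real_def)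

lemma continuous_on_circle_of [continuous_intros]:
  "continuous_on S f \<Longrightarrow> continuous_on S (\<lambda>x. circle_of (f x))"
proof (rule continuous_on_compose2[of UNIV circle_of S f])
  show "continuous_on UNIV circle_of"
    unfolding continuous_on_iff by (meson dist_circle_of_le order_le_less_trans)
qed auto

lemma compact_circle: "compact (UNIV :: circle set)"
proof -
  have "circle_of ` {0..1} = UNIV"
  proof (intro equalityI subsetI)
    fix c :: circle
    obtain x where "c = circle_of x" by (rule circle_exhaust)
    then have "c = circle_of (frac x)" by (simp add: circle_of_eq_iff frac_def)
    moreover have "frac x \<in> {0..1}" by (simp add: frac_lt_1 less_imp_le)
    ultimately show "c \<in> circle_of ` {0..1}" by blast
  qed simp
  moreover have "compact (circle_of ` {0..1})"
    by (intro compact_continuous_image continuous_intros compact_Icc)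
  ultimately show ?thesis by simp
qed

text \<open>For \<open>q < 0\<close> the condition holds trivially, as the right-hand side is negative.\<close>

definition badly_approximable :: "circle \<Rightarrow> bool"
  where "badly_approximable \<alpha> \<longleftrightarrow>
    (\<exists>c>0. \<forall>q::int. q \<noteq> 0 \<longrightarrow> circle_norm (zscale q \<alpha>) > c / of_int q)"

text \<open>From here to \<open>GRP\<close>, \<open>T\<close> is meant to be a homeomorphism of a compact metric space that
  exhausts its type; the definitions themselves do not demand this.
  See \<open>compact_torus2\<close> and \<open>homeomorphism_skew_shift\<close> for the case of interest.\<close>

definition int_iterate :: "('a \<Rightarrow> 'a) \<Rightarrow> int \<Rightarrow> 'a \<Rightarrow> 'a"
  where "int_iterate T n = (if n \<ge> 0 then T ^^ nat n else (inv T) ^^ nat (- n))"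

definition minimal :: "('a::topological_space \<Rightarrow> 'a) \<Rightarrow> bool"
  where "minimal T \<longleftrightarrow> (\<forall>\<omega>. closure (range (\<lambda>n. int_iterate T n \<omega>)) = UNIV)"

definition repetition_property :: "(nat \<Rightarrow> 'a::metric_space) \<Rightarrow> bool"
  where "repetition_property w \<longleftrightarrow>
    (\<forall>\<epsilon>>0. \<forall>r>0. \<exists>q::nat. q > 0 \<and>
       (\<forall>k::nat. int k \<le> \<lfloor>r * real q\<rfloor> \<longrightarrow> dist (w k) (w (k + q)) < \<epsilon>))"

definition PRP :: "('a::metric_space \<Rightarrow> 'a) \<Rightarrow> 'a set"
  where "PRP T = {\<omega>. repetition_property (\<lambda>k. (T ^^ k) \<omega>)}"

definition TRP :: "('a::metric_space \<Rightarrow> 'a) \<Rightarrow> bool"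
  where "TRP T \<longleftrightarrow> PRP T \<noteq> {}"

text \<open>This is meant for a \<open>T\<close>-ergodic Borel probability measure \<open>\<mu>\<close>. No junk value of \<open>emeasure\<close>
  is involved: for continuous \<open>T\<close>, the set \<open>PRP T\<close> is a countable intersection of open sets.\<close>

definition MRP :: "('a::metric_space \<Rightarrow> 'a) \<Rightarrow> 'a measure \<Rightarrow> bool"
  where "MRP T \<mu> \<longleftrightarrow> emeasure \<mu> (PRP T) > 0"

definition GRP :: "('a::metric_space \<Rightarrow> 'a) \<Rightarrow> bool"
  where "GRP T \<longleftrightarrow> PRP T = UNIV"

text \<open>The library metric on the product type is the Euclidean combination of the two circle
  metrics, that is, the flat metric.\<close>

type_synonym torus2 = "circle \<times> circle"

definition skew_shift :: "circle \<Rightarrow> torus2 \<Rightarrow> torus2"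
  where "skew_shift \<alpha> = (\<lambda>(\<omega>\<^sub>1, \<omega>\<^sub>2). (\<omega>\<^sub>1 + zscale 2 \<alpha>, \<omega>\<^sub>1 + \<omega>\<^sub>2))"

lemma continuous_on_add_circle:
  fixes f g :: "'a::topological_space \<Rightarrow> circle"
  assumes "continuous_on S f" "continuous_on S g"
  shows "continuous_on S (\<lambda>x. f x + g x)"
proof -
  have d: "dist (a + b) (a' + b') \<le> dist a a' + dist b b'" for a b a' b' :: circle
    using circle_norm_triangle[of "a - a'" "b - b'"] by (simp add: dist_circle_def add_diff_add)
  show ?thesis unfolding continuous_on_def
  proof
    fix x assume "x \<in> S"
    then have "(f \<longlongrightarrow> f x) (at x within S)" "(g \<longlongrightarrow> g x) (at x within S)"
      using assms by (auto simp: continuous_on_def)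
    then have "((\<lambda>y. dist (f y) (f x)) \<longlongrightarrow> 0) (at x within S)"
              "((\<lambda>y. dist (g y) (g x)) \<longlongrightarrow> 0) (at x within S)"
      by (blast intro: iffD1[OF tendsto_dist_iff])+
    from tendsto_add[OF this]
    have "((\<lambda>y. dist (f y) (f x) + dist (g y) (g x)) \<longlongrightarrow> 0 + 0) (at x within S)" .
    then have "((\<lambda>y. dist (f y) (f x) + dist (g y) (g x)) \<longlongrightarrow> 0) (at x within S)"
      by simp
    then have "((\<lambda>y. dist (f y + g y) (f x + g x)) \<longlongrightarrow> 0) (at x within S)"
      by (rule tendsto_sandwich[OF _ _ tendsto_const, rotated -1]) (simp_all add: d)
    then show "((\<lambda>y. f y + g y) \<longlongrightarrow> f x + g x) (at x within S)"
      by (rule iffD2[OF tendsto_dist_iff])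
  qed
qed

lemma continuous_on_diff_circle:
  fixes f g :: "'a::topological_space \<Rightarrow> circle"
  assumes "continuous_on S f" "continuous_on S g"
  shows "continuous_on S (\<lambda>x. f x - g x)"
proof -
  have "dist (- a) (- b) = dist a b" for a b :: circle
    using circle_norm_minus[of "a - b"] by (simp add: dist_circle_def)
  then have "continuous_on UNIV (uminus :: circle \<Rightarrow> circle)"
    unfolding continuous_on_iff by auto
  then have "continuous_on S (\<lambda>x. - g x)"
    by (rule continuous_on_compose2[OF _ assms(2)]) simp
  from continuous_on_add_circle[OF assms(1) this] show ?thesis by simp
qed

lemma homeomorphism_skew_shift:
  "homeomorphism UNIV UNIV (skew_shift \<alpha>)
     (\<lambda>(\<omega>\<^sub>1, \<omega>\<^sub>2). (\<omega>\<^sub>1 - zscale 2 \<alpha>, \<omega>\<^sub>2 - (\<omega>\<^sub>1 - zscale 2 \<alpha>)))"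
  (is "homeomorphism _ _ _ ?g")
proof (rule homeomorphismI)
  show "continuous_on UNIV (skew_shift \<alpha>)"
    unfolding skew_shift_def case_prod_unfold
    by (intro continuous_intros continuous_on_add_circle)
  show "continuous_on UNIV ?g"
    unfolding case_prod_unfold
    by (intro continuous_intros continuous_on_diff_circle)
qed (auto simp: skew_shift_def)

lemma compact_torus2: "compact (UNIV :: torus2 set)"
  using compact_Times[OF compact_circle compact_circle] by simp

definition leb_torus2 :: "torus2 measure"
  where "leb_torus2 =
    distr (restrict_space lborel ({0..<1} \<times> {0..<1})) borel
      (\<lambda>(x, y). (circle_of x, circle_of y))"

lemma sets_leb_torus2: "sets leb_torus2 = sets borel"
  by (simp add: leb_torus2_def)

lemma prob_space_leb_torus2: "prob_space leb_torus2"
  unfolding leb_torus2_def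
proof (rule prob_space.prob_space_distr)
  let ?S = "{0..<1} \<times> {0..<1} :: (real \<times> real) set"
  have S: "?S \<in> sets borel" by (intro borel_Times) auto
  have "emeasure lborel ?S = emeasure (lborel \<Otimes>\<^sub>M lborel) ?S" by (simp add: lborel_prod)
  also have "\<dots> = 1" by (subst lborel.emeasure_pair_measure_Times) auto
  finally show "prob_space (restrict_space lborel ?S)"
    using S by (intro prob_spaceI) (simp add: emeasure_restrict_space space_restrict_space)
  have "continuous_on UNIV (\<lambda>(x, y). (circle_of x, circle_of y))"
    unfolding case_prod_unfold by (intro continuous_intros)
  then have "(\<lambda>(x, y). (circle_of x, circle_of y)) \<in> borel_measurable lborel"
    by (simp add: borel_measurable_continuous_onI)
  then show "(\<lambda>(x, y). (circle_of x, circle_of y)) \<in> restrict_space lborel ?S \<rightarrow>\<^sub>M borel"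
    by (rule measurable_restrict_space1)
qed

end

theory Submission
  imports Defs
begin

text \<open>
  Iterating the skew-shift gives \<open>T\<^sup>n (x, y) = (x + 2 n \<alpha>, y + n x + n (n - 1) \<alpha>)\<close>, so the
  displacement over a time \<open>q\<close>, seen from time \<open>k\<close>, is
  \<open>T\<^sup>k\<^sup>+\<^sup>q (x, y) - T\<^sup>k (x, y) = (2 q \<alpha>, q x + (q\<^sup>2 - q) \<alpha> + 2 k q \<alpha>)\<close>.
  The second coordinate is an arithmetic progression in \<open>k\<close> with step \<open>2 q \<alpha>\<close>, and the whole theorem
  is about how long such a progression can remain near \<open>0\<close>.

  If a single orbit repeats up to \<open>\<epsilon>\<close> for \<open>k = 0, \<dots>, q\<close>, then the progression moves by at most
  \<open>2 \<epsilon>\<close> during \<open>q\<close> steps. A small step cannot leave a short arc around \<open>0\<close> and come back to it by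
  winding around the circle without being seen outside (\<open>circle_norm_multiples_small\<close>), hence
  \<open>q \<langle>2 q \<alpha>\<rangle> \<le> 2 \<epsilon>\<close>. As \<open>\<epsilon>\<close> is arbitrary, \<open>\<alpha>\<close> is not badly approximable.

  Conversely, suppose that \<open>p \<langle>p \<alpha>\<rangle>\<close> can be made as small as desired. If \<open>q \<langle>q \<alpha>\<rangle>\<close> is small then so
  are \<open>2 q \<alpha>\<close>, \<open>(q\<^sup>2 - q) \<alpha>\<close> and \<open>2 k q \<alpha>\<close> for all \<open>k \<le> r q\<close>; only the term \<open>q x\<close>, which depends
  on the starting point, is left. It is made small by Dirichlet's theorem: some \<open>m \<le> M\<close> brings
  \<open>m (p x)\<close> within \<open>1 / M\<close> of \<open>0\<close>, and passing from \<open>p\<close> to \<open>q = m p\<close> costs only a factor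
  \<open>m\<^sup>2 \<le> M\<^sup>2\<close> in \<open>q \<langle>q \<alpha>\<rangle>\<close>, where \<open>M\<close> depends on \<open>\<epsilon>\<close> alone. So every point has a repeating orbit.

  The metric property lies between the global and the topological one, because Lebesgue measure is a
  probability measure and the empty set is null.
\<close>

section \<open>Integer multiples in the circle group\<close>

lemma zscale_zscale: "zscale a (zscale b c) = zscale (a * b) c"
  by transfer (simp add: algebra_simps)

lemma zscale_add_left: "zscale (a + b) c = zscale a c + zscale b c"
  by transfer (simp add: algebra_simps)

lemma zscale_0_left [simp]: "zscale 0 c = 0"
  by transfer simp

lemma zscale_1_left [simp]: "zscale 1 c = c"
  by transfer simp

lemma circle_norm_nonneg: "0 \<le> circle_norm c"
  by (metis circle_exhaust circle_norm_attained abs_ge_zero)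

lemma circle_norm_diff_le: "circle_norm (c - d) \<le> circle_norm c + circle_norm d"
  using circle_norm_triangle[of c "- d"] by (simp add: circle_norm_minus)

lemma circle_shortest_representative:
  obtains x where "c = circle_of x" "circle_norm c = \<bar>x\<bar>"
proof -
  obtain y where y: "c = circle_of y" by (rule circle_exhaust)
  obtain p where p: "circle_norm c = \<bar>y - of_int p\<bar>" using circle_norm_attained y by metis
  have "c = circle_of (y - of_int p)" by (simp add: y circle_of_eq_iff)
  then show thesis using p that by blast
qed

lemma circle_norm_zscale_le: "circle_norm (zscale n c) \<le> \<bar>real_of_int n\<bar> * circle_norm c"
proof -
  obtain x where x: "c = circle_of x" "circle_norm c = \<bar>x\<bar>"
    by (rule circle_shortest_representative)
  show ?thesis
    using circle_norm_le[of "of_int n * x" 0] x by (simp add: zscale.abs_eq abs_mult)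
qed

text \<open>As long as all multiples \<open>k c\<close> lie within \<open>a < 1 / 3\<close> of \<open>0\<close>, the progression cannot have wound
  around the circle: each step has length at most \<open>a\<close>, whereas the arc outside the
  \<open>a\<close>-neighbourhood of \<open>0\<close> has length \<open>1 - 2 a > a\<close>.\<close>

lemma circle_norm_multiples_small:
  assumes small: "\<And>k. k \<le> n \<Longrightarrow> circle_norm (zscale (int k) c) \<le> a" and a: "a < 1 / 3"
  shows "real n * circle_norm c \<le> a"
proof -
  obtain x where x: "c = circle_of x" "circle_norm c = \<bar>x\<bar>"
    by (rule circle_shortest_representative)
  have "real k * \<bar>x\<bar> \<le> a" if "k \<le> n" for k
    using that
  proof (induction k)
    case 0
    then show ?case using small[of 0] circle_norm_nonneg[of 0] by simp
  next
    case (Suc k)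
    have "\<bar>x\<bar> \<le> a" using small[of 1] Suc.prems x by simp
    moreover have "real k * \<bar>x\<bar> \<le> a" using Suc by simp
    ultimately have two: "\<bar>real (Suc k) * x\<bar> \<le> 2 * a"
      using abs_triangle_ineq[of x "real k * x"] by (simp add: abs_mult algebra_simps)
    obtain p where "circle_norm (circle_of (real (Suc k) * x)) = \<bar>real (Suc k) * x - of_int p\<bar>"
      using circle_norm_attained by metis
    then have p: "\<bar>real (Suc k) * x - of_int p\<bar> \<le> a"
      using small[OF Suc.prems] by (simp add: x zscale.abs_eq)
    have "p = 0"
    proof (rule ccontr)
      assume "p \<noteq> 0"
      then have "1 \<le> \<bar>real_of_int p\<bar>" by linarith
      then show False using two p a by linarith
    qed
    then have "\<bar>real (Suc k) * x\<bar> \<le> a" using p by simp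
    then show ?case by (simp add: abs_mult)
  qed
  then show ?thesis using x by simp
qed

lemma Dirichlet_circle:
  assumes "M > 0"
  obtains m :: nat where "0 < m" "m \<le> M" "circle_norm (zscale (int m) c) < 1 / real M"
proof -
  obtain x where x: "c = circle_of x" by (rule circle_exhaust)
  obtain h k where hk: "0 < k" "k \<le> int M" "\<bar>of_int k * x - of_int h\<bar> < 1 / real M"
    using Dirichlet_approx[OF assms, of x] by metis
  have "circle_norm (zscale k c) < 1 / real M"
    using circle_norm_le[of "of_int k * x" h] hk(3) by (simp add: x zscale.abs_eq)
  then show thesis using hk that[of "nat k"] by simp
qed

section \<open>Orbits of the skew-shift\<close>

lemma skew_shift_funpow:
  "(skew_shift \<alpha> ^^ n) (x, y) =
     (x + zscale (2 * int n) \<alpha>, y + zscale (int n) x + zscale (int n * (int n - 1)) \<alpha>)"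
proof (induction n)
  case 0
  then show ?case by simp
next
  case (Suc n)
  have "zscale (int (Suc n) * (int (Suc n) - 1)) \<alpha>
      = zscale (2 * int n) \<alpha> + zscale (int n * (int n - 1)) \<alpha>"
    by (simp add: zscale_add_left[symmetric] algebra_simps)
  moreover have "zscale (2 * int (Suc n)) \<alpha> = zscale (2 * int n) \<alpha> + zscale 2 \<alpha>"
    by (simp add: zscale_add_left[symmetric] algebra_simps)
  moreover have "zscale (int (Suc n)) x = zscale (int n) x + x"
    by (simp add: zscale_add_left)
  ultimately show ?case
    using Suc by (simp add: skew_shift_def algebra_simps)
qed

text \<open>The displacement over time \<open>q\<close> has a constant first coordinate, and its second coordinate is an
  arithmetic progression in \<open>k\<close> whose step is the first coordinate.\<close>

lemma skew_shift_displacement: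
  "(skew_shift \<alpha> ^^ (k + q)) (x, y) - (skew_shift \<alpha> ^^ k) (x, y) =
     (zscale (2 * int q) \<alpha>,
      zscale (int q) x + zscale (int q * (int q - 1)) \<alpha> + zscale (int k) (zscale (2 * int q) \<alpha>))"
proof -
  have "zscale (int (k + q) * (int (k + q) - 1)) \<alpha>
      = zscale (int k * (int k - 1)) \<alpha> + zscale (int q * (int q - 1)) \<alpha>
        + zscale (int k) (zscale (2 * int q) \<alpha>)"
    by (simp add: zscale_add_left[symmetric] zscale_zscale algebra_simps)
  then show ?thesis
    unfolding skew_shift_funpow by (simp add: zscale_add_left algebra_simps)
qed

lemma dist_torus2_bounds:
  fixes u v :: torus2
  shows "circle_norm (snd (u - v)) \<le> dist u v"
    and "dist u v \<le> circle_norm (fst (u - v)) + circle_norm (snd (u - v))"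
proof -
  show "circle_norm (snd (u - v)) \<le> dist u v"
    using dist_snd_le[of u v] by (simp add: dist_circle_def)
  show "dist u v \<le> circle_norm (fst (u - v)) + circle_norm (snd (u - v))"
    using sqrt_sum_squares_le_sum[of "dist (fst u) (fst v)" "dist (snd u) (snd v)"]
    by (simp add: dist_prod_def) (simp add: dist_circle_def)
qed

section \<open>Approximability and repetition\<close>

text \<open>Already the case \<open>r = 1\<close> of the repetition property, along one orbit, bounds \<open>q \<langle>2 q \<alpha>\<rangle>\<close>.\<close>

lemma TRP_imp_not_badly_approximable:
  assumes "TRP (skew_shift \<alpha>)"
  shows "\<not> badly_approximable \<alpha>"
proof
  assume "badly_approximable \<alpha>"
  then obtain c where "c > 0"
    and c: "\<And>q::int. q \<noteq> 0 \<Longrightarrow> circle_norm (zscale q \<alpha>) > c / of_int q"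
    unfolding badly_approximable_def by blast
  obtain x y where "(x, y) \<in> PRP (skew_shift \<alpha>)"
    using assms unfolding TRP_def by auto
  then have rep: "repetition_property (\<lambda>k. (skew_shift \<alpha> ^^ k) (x, y))"
    by (simp add: PRP_def)
  \<comment> \<open>The constants ensure \<open>2 \<epsilon> < 1 / 3\<close>, for the absence of winding, and \<open>2 \<epsilon> \<le> c / 2\<close>.\<close>
  define \<epsilon> where "\<epsilon> = min (1 / 8) (c / 4)"
  have "\<epsilon> > 0" using \<open>c > 0\<close> by (simp add: \<epsilon>_def)
  then obtain q where "q > 0"
    and q: "\<And>k. k \<le> q \<Longrightarrow>
      dist ((skew_shift \<alpha> ^^ k) (x, y)) ((skew_shift \<alpha> ^^ (k + q)) (x, y)) < \<epsilon>"
    using rep[unfolded repetition_property_def, rule_format, of \<epsilon> 1] by auto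
  define s where "s = zscale (2 * int q) \<alpha>"
  define b where "b = zscale (int q) x + zscale (int q * (int q - 1)) \<alpha>"
  have near: "circle_norm (b + zscale (int k) s) < \<epsilon>" if "k \<le> q" for k
    using q[OF that]
      dist_torus2_bounds(1)[of "(skew_shift \<alpha> ^^ (k + q)) (x, y)" "(skew_shift \<alpha> ^^ k) (x, y)"]
    unfolding skew_shift_displacement by (simp add: s_def b_def dist_commute)
  have "circle_norm (zscale (int k) s) \<le> 2 * \<epsilon>" if "k \<le> q" for k
    using circle_norm_diff_le[of "b + zscale (int k) s" b] near[OF that] near[of 0] by simp
  then have "real q * circle_norm s \<le> 2 * \<epsilon>"
    by (rule circle_norm_multiples_small) (simp_all add: \<epsilon>_def)
  moreover have "real q * circle_norm s > c / 2"
    using c[of "2 * int q"] \<open>q > 0\<close> by (simp add: s_def field_simps)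
  ultimately show False by (simp add: \<epsilon>_def)
qed

text \<open>Negative denominators \<open>q\<close> never witness the failure of bad approximability, because \<open>c / q\<close> is
  then negative; so the witnesses can be taken to be natural numbers.\<close>

lemma not_badly_approximableE:
  assumes "\<not> badly_approximable \<alpha>" "c > 0"
  obtains p :: nat where "p > 0" "real p * circle_norm (zscale (int p) \<alpha>) \<le> c"
proof -
  obtain q :: int where q: "q \<noteq> 0" "circle_norm (zscale q \<alpha>) \<le> c / of_int q"
    using assms unfolding badly_approximable_def by (meson not_le)
  have "0 \<le> c / of_int q" using q(2) circle_norm_nonneg order_trans by blast
  then have "q > 0" using q(1) \<open>c > 0\<close> by (simp add: zero_le_divide_iff)
  then show thesis using q(2) that[of "nat q"] by (simp add: field_simps)
qed

text \<open>The good denominators of \<open>\<alpha>\<close> may be replaced by bounded multiples that return a prescribed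
  point \<open>x\<close> close to \<open>0\<close>.\<close>

lemma not_badly_approximable_simultaneous:
  assumes "\<not> badly_approximable \<alpha>" "\<delta> > 0" "\<eta> > 0"
  obtains q :: nat where "q > 0" "real q * circle_norm (zscale (int q) \<alpha>) \<le> \<eta>"
    "circle_norm (zscale (int q) x) < \<delta>"
proof -
  obtain M :: nat where M: "M > 0" "1 / real M < \<delta>"
    using reals_Archimedean[OF \<open>\<delta> > 0\<close>] by (metis inverse_eq_divide zero_less_Suc)
  have "\<eta> / (real M)\<^sup>2 > 0" using M \<open>\<eta> > 0\<close> by simp
  then obtain p :: nat where p: "p > 0"
    "real p * circle_norm (zscale (int p) \<alpha>) \<le> \<eta> / (real M)\<^sup>2"
    using not_badly_approximableE[OF assms(1)] by blast
  obtain m :: nat where m: "0 < m" "m \<le> M"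
    "circle_norm (zscale (int m) (zscale (int p) x)) < 1 / real M"
    using Dirichlet_circle[OF M(1)] by blast
  have "real (m * p) * circle_norm (zscale (int (m * p)) \<alpha>)
      \<le> real (m * p) * (real m * circle_norm (zscale (int p) \<alpha>))"
    using circle_norm_zscale_le[of "int m" "zscale (int p) \<alpha>"]
    by (intro mult_left_mono) (simp_all add: zscale_zscale)
  also have "\<dots> = (real m)\<^sup>2 * (real p * circle_norm (zscale (int p) \<alpha>))"
    by (simp add: power2_eq_square)
  also have "\<dots> \<le> (real M)\<^sup>2 * (\<eta> / (real M)\<^sup>2)"
    using m p by (intro mult_mono power_mono) (simp_all add: circle_norm_nonneg)
  also have "\<dots> = \<eta>" using M by simp
  finally have "real (m * p) * circle_norm (zscale (int (m * p)) \<alpha>) \<le> \<eta>" .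
  moreover have "circle_norm (zscale (int (m * p)) x) < \<delta>"
    using m(3) M(2) by (simp add: zscale_zscale)
  ultimately show thesis using that[of "m * p"] m(1) p(1) by simp
qed

lemma not_badly_approximable_imp_GRP:
  assumes "\<not> badly_approximable \<alpha>"
  shows "GRP (skew_shift \<alpha>)"
proof -
  have "repetition_property (\<lambda>k. (skew_shift \<alpha> ^^ k) (x, y))" for x y
    unfolding repetition_property_def
  proof (intro allI impI)
    fix \<epsilon> r :: real
    assume "\<epsilon> > 0" "r > 0"
    \<comment> \<open>With \<open>N = q \<langle>q \<alpha>\<rangle>\<close>, the terms of the displacement that involve \<open>\<alpha>\<close> contribute at most \<open>2 N\<close>,
      \<open>N\<close> and \<open>2 r N\<close>, which explains the factor \<open>2 r + 3\<close>.\<close>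
    have "\<epsilon> / 2 / (2 * r + 3) > 0" using \<open>\<epsilon> > 0\<close> \<open>r > 0\<close> by simp
    moreover have "\<epsilon> / 2 > 0" using \<open>\<epsilon> > 0\<close> by simp
    ultimately obtain q :: nat where "q > 0"
      and q: "real q * circle_norm (zscale (int q) \<alpha>) \<le> \<epsilon> / 2 / (2 * r + 3)"
      and qx: "circle_norm (zscale (int q) x) < \<epsilon> / 2"
      using not_badly_approximable_simultaneous[OF assms] by blast
    define N where "N = real q * circle_norm (zscale (int q) \<alpha>)"
    have N: "(2 * r + 3) * N \<le> \<epsilon> / 2"
      using q \<open>r > 0\<close> by (simp add: N_def field_simps)
    have multiple: "circle_norm (zscale (j * int q) \<alpha>) \<le> t * N"
      if "\<bar>real_of_int j\<bar> \<le> t * real q" for j t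
    proof -
      have "circle_norm (zscale (j * int q) \<alpha>)
          \<le> \<bar>real_of_int j\<bar> * circle_norm (zscale (int q) \<alpha>)"
        using circle_norm_zscale_le[of j "zscale (int q) \<alpha>"] by (simp add: zscale_zscale)
      also have "\<dots> \<le> t * real q * circle_norm (zscale (int q) \<alpha>)"
        using that by (intro mult_right_mono circle_norm_nonneg)
      finally show ?thesis by (simp add: N_def)
    qed
    have "dist ((skew_shift \<alpha> ^^ k) (x, y)) ((skew_shift \<alpha> ^^ (k + q)) (x, y)) < \<epsilon>"
      if k: "int k \<le> \<lfloor>r * real q\<rfloor>" for k
    proof -
      have kr: "real k \<le> r * real q"
        using k by (simp add: le_floor_iff)
      have step: "circle_norm (zscale (2 * int q) \<alpha>) \<le> 2 * N"
        using \<open>q > 0\<close> by (intro multiple) simp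
      have offset: "circle_norm (zscale (int q * (int q - 1)) \<alpha>) \<le> N"
        using multiple[of "int q - 1" 1] \<open>q > 0\<close> by (simp add: mult.commute)
      have drift: "circle_norm (zscale (int k) (zscale (2 * int q) \<alpha>)) \<le> 2 * r * N"
        using multiple[of "2 * int k" "2 * r"] kr by (simp add: zscale_zscale mult.assoc mult.left_commute)
      have "dist ((skew_shift \<alpha> ^^ (k + q)) (x, y)) ((skew_shift \<alpha> ^^ k) (x, y))
          \<le> circle_norm (zscale (2 * int q) \<alpha>)
            + circle_norm (zscale (int q) x + zscale (int q * (int q - 1)) \<alpha>
                           + zscale (int k) (zscale (2 * int q) \<alpha>))"
        using dist_torus2_bounds(2)[of "(skew_shift \<alpha> ^^ (k + q)) (x, y)"
            "(skew_shift \<alpha> ^^ k) (x, y)"]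
        unfolding skew_shift_displacement by simp
      also have "\<dots> \<le> 2 * N + (circle_norm (zscale (int q) x) + N + 2 * r * N)"
        using step offset drift
          circle_norm_triangle[of "zscale (int q) x" "zscale (int q * (int q - 1)) \<alpha>"]
          circle_norm_triangle[of "zscale (int q) x + zscale (int q * (int q - 1)) \<alpha>"
            "zscale (int k) (zscale (2 * int q) \<alpha>)"]
        by linarith
      also have "\<dots> < \<epsilon>"
        using N qx by (simp add: algebra_simps)
      finally show ?thesis by (simp add: dist_commute)
    qed
    then show "\<exists>q>0. \<forall>k. int k \<le> \<lfloor>r * real q\<rfloor> \<longrightarrow>
        dist ((skew_shift \<alpha> ^^ k) (x, y)) ((skew_shift \<alpha> ^^ (k + q)) (x, y)) < \<epsilon>"
      using \<open>q > 0\<close> by blast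
  qed
  then show ?thesis unfolding GRP_def PRP_def by auto
qed

lemma GRP_imp_MRP:
  assumes "GRP T" "prob_space \<mu>" "space \<mu> = UNIV"
  shows "MRP T \<mu>"
  using assms prob_space.emeasure_space_1[OF assms(2)] by (simp add: GRP_def MRP_def)

lemma MRP_imp_TRP: "MRP T \<mu> \<Longrightarrow> TRP T"
  by (auto simp: MRP_def TRP_def)

theorem theorem4:
  fixes \<alpha> :: circle
  assumes "minimal (skew_shift \<alpha>)"
  shows "(\<not> badly_approximable \<alpha> \<longleftrightarrow> GRP (skew_shift \<alpha>)) \<and>
         (GRP (skew_shift \<alpha>) \<longleftrightarrow> MRP (skew_shift \<alpha>) leb_torus2) \<and>
         (MRP (skew_shift \<alpha>) leb_torus2 \<longleftrightarrow> TRP (skew_shift \<alpha>))"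
proof -
  have "space leb_torus2 = UNIV"
    by (simp add: leb_torus2_def)
  then have "GRP (skew_shift \<alpha>) \<Longrightarrow> MRP (skew_shift \<alpha>) leb_torus2"
    using GRP_imp_MRP prob_space_leb_torus2 by blast
  then show ?thesis
    using not_badly_approximable_imp_GRP TRP_imp_not_badly_approximable MRP_imp_TRP by blast
qed

end
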